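(* Let $k>0$ be real, let $\alpha,\beta,\beta',\gamma\in\mathbb{C}$ with $\gamma\notin\{0,-k,-2k,\dots\}$, and let $x,y\in\mathbb{C}$ with $|x|<\frac1k$, $|y|<\frac1k$. (i) If $\left|\frac{x}{1-kx}\right|<\frac1k$ and $\left|\frac{x-y}{1-kx}\right|<\frac1k$, then $$F_{1,k}(\alpha,\beta,\beta';\gamma;x,y)=(1-kx)^{-\frac{\alpha}{k}}F_{1,k}\left(\alpha,\gamma-\beta-\beta',\beta';\gamma;-\frac{x}{1-kx},-\frac{x-y}{1-kx}\right).$$ (ii) If $\left|\frac{y}{1-ky}\right|<\frac1k$ and $\left|\frac{y-x}{1-ky}\right|<\frac1k$, then $$F_{1,k}(\alpha,\beta,\beta';\gamma;x,y)=(1-ky)^{-\frac{\alpha}{k}}F_{1,k}\left(\alpha,\beta,\gamma-\beta-\beta';\gamma;-\frac{y-x}{1-ky},-\frac{y}{1-ky}\right).$$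
   Context: For real $k>0$, $a\in\mathbb{C}$ and an integer $n\ge 1$, the Pochhammer $k$-symbol is $(a)_{n,k}=a(a+k)(a+2k)\cdots(a+(n-1)k)$, and $(a)_{0,k}=1$. The first Appell $k$-function is $$F_{1,k}(\alpha,\beta,\beta';\gamma;x,y)=\sum_{m,n=0}^\infty\frac{(\alpha)_{m+n,k}(\beta)_{m,k}(\beta')_{n,k}}{(\gamma)_{m+n,k}}\frac{x^m}{m!}\frac{y^n}{n!},\qquad |x|<\tfrac1k,\ |y|<\tfrac1k.$$ Complex powers are principal values. *)

theory Defs
  imports "HOL-Analysis.Analysis"
begin

definition pochhammer_k :: "real \<Rightarrow> complex \<Rightarrow> nat \<Rightarrow> complex" where
  "pochhammer_k k a n = (\<Prod>i<n. a + of_nat i * of_real k)"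

text \<open>
  The double series is read as an unordered sum over all pairs of natural numbers. It converges
  absolutely for \<open>norm x < 1 / k\<close> and \<open>norm y < 1 / k\<close>, provided \<open>\<gamma>\<close> is not one of
  \<open>0, -k, -2k, \<dots>\<close>; outside that range the value is not meaningful.
\<close>

definition appell_F1_k ::
  "real \<Rightarrow> complex \<Rightarrow> complex \<Rightarrow> complex \<Rightarrow> complex \<Rightarrow> complex \<Rightarrow> complex \<Rightarrow> complex" where
  "appell_F1_k k \<alpha> \<beta> \<beta>' \<gamma> x y =
    (\<Sum>\<^sub>\<infinity>(m, n)\<in>UNIV.
      pochhammer_k k \<alpha> (m + n) * pochhammer_k k \<beta> m * pochhammer_k k \<beta>' n /
        pochhammer_k k \<gamma> (m + n) * (x ^ m / fact m) * (y ^ n / fact n))"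

end

theory Submission
  imports Defs "HOL-Complex_Analysis.Complex_Analysis"
begin

text \<open>
  The substitution \<open>u = k x\<close>, \<open>v = k y\<close> together with \<open>(a)\<^sub>n\<^sub>,\<^sub>k = k\<^sup>n (a/k)\<^sub>n\<close> turns the claim into
  one about the classical Appell function \<open>F\<^sub>1\<close>, namely
  \<open>F\<^sub>1(a, b, b'; c; x, y) = (1 - x)\<^sup>-\<^sup>a F\<^sub>1(a, c - b - b', b'; c; -x/(1-x), -(x-y)/(1-x))\<close>.
  Part (ii) is part (i) with the two variables exchanged, because \<open>F\<^sub>1\<close> is symmetric under
  swapping \<open>(b, x)\<close> with \<open>(b', y)\<close>.

  The usual derivation goes through Euler's integral, which needs restrictions on \<open>a\<close> and \<open>c\<close>.
  The argument here avoids it by grouping the double series by total degree: \<open>F\<^sub>1(t x, t y)\<close> is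
  the power series in \<open>t\<close> obtained from the expansion of \<open>(1 - x t)\<^sup>-\<^sup>b (1 - y t)\<^sup>-\<^sup>b\<^sup>'\<close> by multiplying
  the \<open>n\<close>-th coefficient with \<open>(a)\<^sub>n / (c)\<^sub>n\<close>. Write \<open>W\<close> for this multiplication of coefficients
  and let \<open>h(t) = t / (1 - x t)\<close>. From the binomial series, the coefficient of \<open>t\<^sup>M\<close> in
  \<open>(1 - x t)\<^sup>-\<^sup>a r(h(t))\<close> is a sum of the terms \<open>r\<^sub>i (a + i)\<^sub>M\<^sub>-\<^sub>i x\<^sup>M\<^sup>-\<^sup>i / (M - i)!\<close>, and
  \<open>(a)\<^sub>i (a + i)\<^sub>M\<^sub>-\<^sub>i = (a)\<^sub>M\<close>. Hence
  \<open>(1 - x t)\<^sup>-\<^sup>a (W r)(h(t)) = W ((1 - x t)\<^sup>-\<^sup>c r(h(t)))\<close>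
  (\<open>pochhammer_weight_euler_transform\<close>): the weight can be pulled out at the price of replacing the
  exponent \<open>a\<close> by \<open>c\<close>. What remains below the weight is an identity between products of
  elementary powers, which follows from \<open>1 - z h(t) = (1 - (x + z) t) / (1 - x t)\<close>. This proves the
  transformation as an identity of formal power series in \<open>t\<close> (\<open>appell_F1_fps_transform\<close>).

  Formal equality gives equality of the two sides for small \<open>t\<close> only. The set of all complex \<open>t\<close>
  for which \<open>(t x, t y)\<close> satisfies the hypotheses of the theorem is open and star-shaped with
  respect to 0, and both sides are holomorphic on it, so the identity theorem carries the equality
  to \<open>t = 1\<close> (\<open>appell_F1_transform\<close>).
\<close>

unbundle no vec_syntax

section \<open>The series of the powers of a linear factor\<close>

text \<open>The formal power series of \<open>(1 - x t)\<^sup>-\<^sup>c\<close> in \<open>t\<close>.\<close>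
definition neg_binomial_fps :: "complex \<Rightarrow> complex \<Rightarrow> complex fps" where
  "neg_binomial_fps x c = Abs_fps (\<lambda>n. pochhammer c n * x ^ n / fact n)"

lemma neg_binomial_fps_eq_compose:
  "neg_binomial_fps x c = fps_binomial (-c) oo (fps_const (-x) * fps_X)"
  unfolding neg_binomial_fps_def fps_compose_linear fps_eq_iff
  by (simp add: gbinomial_pochhammer power_minus[of x] field_simps flip: power_add)

lemma neg_binomial_fps_add:
  "neg_binomial_fps x (a + b) = neg_binomial_fps x a * neg_binomial_fps x b"
proof -
  have "fps_binomial (-(a + b)) = fps_binomial (-a) * fps_binomial (-b)"
    using fps_binomial_add_mult[of "-a" "-b"] by simp
  thus ?thesis
    by (simp add: neg_binomial_fps_eq_compose fps_compose_mult_distrib)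
qed

lemma neg_binomial_fps_0_right [simp]: "neg_binomial_fps x 0 = 1"
  by (simp add: neg_binomial_fps_eq_compose)

lemma neg_binomial_fps_1_power: "neg_binomial_fps x 1 ^ i = neg_binomial_fps x (of_nat i)"
proof (induction i)
  case (Suc i)
  have "neg_binomial_fps x (of_nat (Suc i)) = neg_binomial_fps x 1 * neg_binomial_fps x (of_nat i)"
    by (simp flip: neg_binomial_fps_add)
  with Suc show ?case by simp
qed simp

lemma has_fps_expansion_neg_binomial:
  "(\<lambda>t. (1 - x * t) powr (-c)) has_fps_expansion neg_binomial_fps x c"
proof -
  have "((\<lambda>t. (1 + t) powr (-c)) \<circ> (\<lambda>t. (-x) * t)) has_fps_expansion
          (fps_binomial (-c) oo (fps_const (-x) * fps_X))"
    by (intro fps_expansion_intros) auto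
  thus ?thesis by (simp add: neg_binomial_fps_eq_compose o_def)
qed

section \<open>Substituting a Moebius transformation\<close>

text \<open>
  The formal power series of \<open>t / (1 - x t)\<close>. With \<open>x\<close> scaled to \<open>t x\<close>, the new arguments
  \<open>-x/(1-x)\<close> and \<open>-(x-y)/(1-x)\<close> of the Appell function become this function of \<open>t\<close>
  times \<open>-x\<close> and \<open>y - x\<close>.
\<close>
definition moebius_fps :: "complex \<Rightarrow> complex fps" where
  "moebius_fps x = fps_X * neg_binomial_fps x 1"

lemma moebius_fps_nth_0 [simp]: "moebius_fps x $ 0 = 0"
  by (simp add: moebius_fps_def)

lemma eventually_Re_one_minus_mult_pos: "eventually (\<lambda>t. Re (1 - x * t) > 0) (nhds 0)"
proof -
  have "open {t. Re (1 - x * t) > 0}"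
    by (intro open_Collect_less continuous_intros)
  thus ?thesis
    using eventually_nhds_in_open[of "{t. Re (1 - x * t) > 0}" 0] by simp
qed

lemma has_fps_expansion_moebius: "(\<lambda>t. t / (1 - x * t)) has_fps_expansion moebius_fps x"
proof -
  have "(\<lambda>t. t * (1 - x * t) powr (-1)) has_fps_expansion moebius_fps x"
    unfolding moebius_fps_def
    by (intro fps_expansion_intros has_fps_expansion_neg_binomial)
  moreover have "eventually (\<lambda>t. t * (1 - x * t) powr (-1) = t / (1 - x * t)) (nhds 0)"
    using eventually_Re_one_minus_mult_pos[of x]
  proof eventually_elim
    case (elim t)
    hence "1 - x * t \<noteq> 0" by force
    thus ?case by (simp add: powr_minus divide_simps)
  qed
  ultimately show ?thesis
    by (subst has_fps_expansion_cong[OF _ refl, symmetric])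
qed

text \<open>
  In the right half-plane the arguments lie in \<open>(-\<pi>/2, \<pi>/2)\<close>, so their difference is still the
  principal argument of the quotient.
\<close>
lemma powr_divide_Re_pos:
  fixes w z s :: complex
  assumes "Re w > 0" "Re z > 0"
  shows "(w / z) powr s = w powr s * z powr (-s)"
proof -
  have nz: "w \<noteq> 0" "z \<noteq> 0" using assms by auto
  have "\<bar>Im (Ln w)\<bar> < pi / 2" "\<bar>Im (Ln z)\<bar> < pi / 2"
    using assms by (blast intro: Re_Ln_pos_lt_imp)+
  moreover have "w / z = exp (Ln w - Ln z)"
    using nz by (simp add: exp_diff)
  ultimately have "Ln (w / z) = Ln w - Ln z"
    using Ln_exp[of "Ln w - Ln z"] by auto
  thus ?thesis
    using nz by (simp add: powr_def right_diff_distrib flip: exp_add)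
qed

text \<open>
  This is \<open>1 - z t / (1 - x t) = (1 - (x + z) t) / (1 - x t)\<close> raised to the power \<open>-d\<close>. Both sides
  are the expansions at 0 of the same function, where principal values multiply as expected
  because the bases are close to 1.
\<close>
lemma neg_binomial_fps_compose_moebius:
  "neg_binomial_fps z d oo moebius_fps x = neg_binomial_fps (x + z) d * neg_binomial_fps x (-d)"
proof -
  let ?f = "(\<lambda>u. (1 - z * u) powr (-d)) \<circ> (\<lambda>t. t / (1 - x * t))"
  let ?g = "\<lambda>t. (1 - (x + z) * t) powr (-d) * (1 - x * t) powr (-(-d))"
  have "?f has_fps_expansion (neg_binomial_fps z d oo moebius_fps x)"
    by (intro has_fps_expansion_compose has_fps_expansion_neg_binomial has_fps_expansion_moebius) auto
  moreover have "?g has_fps_expansion neg_binomial_fps (x + z) d * neg_binomial_fps x (-d)"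
    by (intro has_fps_expansion_mult has_fps_expansion_neg_binomial)
  moreover have "eventually (\<lambda>t. ?f t = ?g t) (nhds 0)"
    using eventually_Re_one_minus_mult_pos[of x] eventually_Re_one_minus_mult_pos[of "x + z"]
  proof eventually_elim
    case (elim t)
    hence "1 - x * t \<noteq> 0" by force
    hence "1 - z * (t / (1 - x * t)) = (1 - (x + z) * t) / (1 - x * t)"
      by (simp add: divide_simps) (simp add: algebra_simps)
    hence "?f t = ((1 - (x + z) * t) / (1 - x * t)) powr (-d)"
      by (simp add: o_def)
    also have "\<dots> = ?g t"
      using elim by (intro powr_divide_Re_pos)
    finally show ?case .
  qed
  ultimately show ?thesis
    using has_fps_expansion_cong[of ?f ?g] fps_expansion_unique_complex[of ?g] by blast
qed

section \<open>Moving the Pochhammer weights through the substitution\<close>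

text \<open>
  The monomial \<open>u\<^sup>i\<close> of \<open>r\<close> turns into \<open>t\<^sup>i (1 - x t)\<^sup>-\<^sup>i\<close>, so that the prefactor raises the exponent to
  \<open>a + i\<close>, and the binomial series gives its coefficients.
\<close>
lemma euler_transform_nth:
  "(neg_binomial_fps x a * (r oo moebius_fps x)) $ M =
     (\<Sum>i\<le>M. r $ i * (pochhammer (a + of_nat i) (M - i) * x ^ (M - i) / fact (M - i)))"
proof -
  let ?h = "moebius_fps x"
  have h_power: "?h ^ i = fps_X ^ i * neg_binomial_fps x (of_nat i)" for i
    by (simp add: moebius_fps_def power_mult_distrib neg_binomial_fps_1_power)
  \<comment> \<open>A common upper summation bound for all \<open>j\<close>, so that the two sums can be interchanged.\<close>
  have compose: "(r oo ?h) $ j = (\<Sum>i\<le>M. r $ i * (?h ^ i) $ j)" if "j \<le> M" for j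
    unfolding fps_compose_nth
    by (rule sum.mono_neutral_left) (use that in \<open>auto simp: h_power fps_X_power_mult_nth\<close>)
  have "(neg_binomial_fps x a * (r oo ?h)) $ M =
          (\<Sum>j=0..M. \<Sum>i\<le>M. r $ i * (neg_binomial_fps x a $ j * (?h ^ i) $ (M - j)))"
    unfolding fps_mult_nth by (simp add: compose sum_distrib_left mult_ac)
  also have "\<dots> = (\<Sum>i\<le>M. r $ i * (neg_binomial_fps x a * ?h ^ i) $ M)"
    unfolding fps_mult_nth sum_distrib_left by (rule sum.swap)
  also have "(\<lambda>i. neg_binomial_fps x a * ?h ^ i) =
               (\<lambda>i. fps_X ^ i * neg_binomial_fps x (a + of_nat i))"
    by (auto simp: h_power neg_binomial_fps_add mult_ac)
  finally show ?thesis
    by (simp add: fps_X_power_mult_nth neg_binomial_fps_def)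
qed

definition pochhammer_weight :: "complex \<Rightarrow> complex \<Rightarrow> complex fps \<Rightarrow> complex fps" where
  "pochhammer_weight a c r = Abs_fps (\<lambda>n. pochhammer a n / pochhammer c n * r $ n)"

lemma pochhammer_nonzero:
  fixes c :: complex
  assumes "\<And>j::nat. c \<noteq> - of_nat j"
  shows "pochhammer c n \<noteq> 0"
  using assms by (auto simp: pochhammer_eq_0_iff)

text \<open>
  Both \<open>(a)\<^sub>i (a + i)\<^sub>M\<^sub>-\<^sub>i = (a)\<^sub>M\<close> and \<open>(c)\<^sub>i (c + i)\<^sub>M\<^sub>-\<^sub>i = (c)\<^sub>M\<close>, so the weight of index \<open>i\<close> combines with the
  coefficient of the transformation to a weight that depends on \<open>M\<close> only.
\<close>
lemma pochhammer_weight_euler_transform: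
  assumes c: "\<And>j::nat. c \<noteq> - of_nat j"
  shows "neg_binomial_fps x a * (pochhammer_weight a c r oo moebius_fps x) =
           pochhammer_weight a c (neg_binomial_fps x c * (r oo moebius_fps x))"
proof (rule fps_ext)
  fix M
  have "pochhammer a i / pochhammer c i * r $ i *
          (pochhammer (a + of_nat i) (M - i) * x ^ (M - i) / fact (M - i)) =
        pochhammer a M / pochhammer c M *
          (r $ i * (pochhammer (c + of_nat i) (M - i) * x ^ (M - i) / fact (M - i)))"
    if "i \<le> M" for i
    using pochhammer_product[OF that, of a] pochhammer_product[OF that, of c]
      pochhammer_nonzero[OF c, of M]
    by (auto simp: field_simps)
  thus "(neg_binomial_fps x a * (pochhammer_weight a c r oo moebius_fps x)) $ M =
          pochhammer_weight a c (neg_binomial_fps x c * (r oo moebius_fps x)) $ M"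
    unfolding pochhammer_weight_def by (simp add: euler_transform_nth sum_distrib_left)
qed

text \<open>
  The power series of \<open>t \<mapsto> F\<^sub>1(a, b, b'; c; t x, t y)\<close>. The factor \<open>(a)\<^sub>m\<^sub>+\<^sub>n / (c)\<^sub>m\<^sub>+\<^sub>n\<close> depends only on the
  total degree, and without it the double series is the product of two binomial series.
\<close>
definition appell_F1_fps ::
  "complex \<Rightarrow> complex \<Rightarrow> complex \<Rightarrow> complex \<Rightarrow> complex \<Rightarrow> complex \<Rightarrow> complex fps" where
  "appell_F1_fps a b b' c x y =
     pochhammer_weight a c (neg_binomial_fps x b * neg_binomial_fps y b')"

text \<open>
  Once the weight is pulled out, the powers of \<open>1 - x t\<close> have the exponents
  \<open>-c + (c - b - b') + b' = -b\<close>, and the factor with parameter \<open>-x\<close> becomes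
  a power of \<open>1 - (x + (-x)) t = 1\<close>.
\<close>
lemma appell_F1_fps_transform:
  assumes c: "\<And>j::nat. c \<noteq> - of_nat j"
  shows "appell_F1_fps a b b' c x y =
           neg_binomial_fps x a *
           (appell_F1_fps a (c - b - b') b' c (-x) (y - x) oo moebius_fps x)"
proof -
  have "neg_binomial_fps x c *
          ((neg_binomial_fps (-x) (c - b - b') * neg_binomial_fps (y - x) b') oo moebius_fps x) =
        neg_binomial_fps x (c + -(c - b - b') + -b') * neg_binomial_fps 0 (c - b - b') * 
          neg_binomial_fps y b'"
    by (simp only: fps_compose_mult_distrib[OF moebius_fps_nth_0] neg_binomial_fps_compose_moebius
          neg_binomial_fps_add) (simp add: mult_ac)
  also have "neg_binomial_fps 0 (c - b - b') = 1"
    by (auto simp: neg_binomial_fps_def fps_eq_iff power_0_left)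
  finally show ?thesis
    by (simp add: appell_F1_fps_def pochhammer_weight_euler_transform[OF c])
qed

section \<open>The classical Appell function as the sum of its series\<close>
definition appell_F1 ::
  "complex \<Rightarrow> complex \<Rightarrow> complex \<Rightarrow> complex \<Rightarrow> complex \<Rightarrow> complex \<Rightarrow> complex" where
  "appell_F1 a b b' c x y =
    (\<Sum>\<^sub>\<infinity>(m, n)\<in>UNIV.
      pochhammer a (m + n) * pochhammer b m * pochhammer b' n /
        pochhammer c (m + n) * (x ^ m / fact m) * (y ^ n / fact n))"

text \<open>
  Each term arises from the previous one by the factor \<open>(a + n) / (c + n)\<close>, which tends to 1 and is
  therefore eventually smaller in norm than \<open>sqrt q < q\<close>.
  Applied with \<open>c = 1\<close> it also bounds \<open>(b)\<^sub>n / n!\<close>.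
\<close>
lemma pochhammer_quotient_bound:
  fixes a c :: complex and q :: real
  assumes c: "\<And>j::nat. c \<noteq> - of_nat j" and q: "q > 1"
  obtains C where "\<And>n. norm (pochhammer a n / pochhammer c n) \<le> C * q ^ n"
proof -
  \<comment> \<open>Boundedness of these terms is the claim; it follows from their summability.\<close>
  let ?f = "\<lambda>n. pochhammer a n / pochhammer c n / of_real q ^ n"
  have "(\<lambda>n. norm ((a + of_nat n) / (c + of_nat n))) \<longlonglongrightarrow> norm (1 :: complex)"
  proof (intro tendsto_norm)
    have "(\<lambda>n. 1 + (a - c) / (c + of_nat n)) \<longlonglongrightarrow> 1 + 0"
      by (intro tendsto_add tendsto_const tendsto_divide_0[OF tendsto_const]
            tendsto_add_filterlim_at_infinity[OF tendsto_const tendsto_of_nat])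
    moreover have "1 + (a - c) / (c + of_nat n) = (a + of_nat n) / (c + of_nat n)" for n
      using c[of n] by (simp add: divide_simps eq_neg_iff_add_eq_0)
    ultimately show "(\<lambda>n. (a + of_nat n) / (c + of_nat n)) \<longlonglongrightarrow> 1"
      by simp
  qed
  hence "eventually (\<lambda>n. norm ((a + of_nat n) / (c + of_nat n)) < sqrt q) sequentially"
    using q by (intro order_tendstoD) auto
  then obtain N where N: "\<And>n. n \<ge> N \<Longrightarrow> norm ((a + of_nat n) / (c + of_nat n)) < sqrt q"
    by (auto simp: eventually_sequentially)
  have "Bseq ?f"
  proof (rule summable_imp_Bseq, rule summable_ratio_test)
    show "sqrt q / q < 1"
      using q by (simp add: real_less_lsqrt power2_eq_square)
    fix n assume n: "n \<ge> N"
    have "norm (?f (Suc n)) = norm ((a + of_nat n) / (c + of_nat n)) / q * norm (?f n)"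
      using q by (simp add: pochhammer_Suc norm_mult norm_divide norm_power mult_ac)
    also have "\<dots> \<le> sqrt q / q * norm (?f n)"
      using N[OF n] q by (intro mult_right_mono divide_right_mono) auto
    finally show "norm (?f (Suc n)) \<le> sqrt q / q * norm (?f n)" .
  qed
  then obtain C where C: "\<And>n. norm (?f n) \<le> C"
    by (auto elim!: BseqE)
  show ?thesis
  proof (rule that)
    fix n
    have f_eq: "norm (?f n) = norm (pochhammer a n / pochhammer c n) / q ^ n"
      using q by (simp add: norm_divide norm_mult norm_power)
    show "norm (pochhammer a n / pochhammer c n) \<le> C * q ^ n"
      using C[of n] unfolding f_eq using q by (simp only: pos_divide_le_eq zero_less_power less_trans[OF zero_less_one])
  qed
qed

lemma summable_on_geometric_product:
  fixes u v :: real
  assumes "0 \<le> u" "u < 1" "0 \<le> v" "v < 1"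
  shows "(\<lambda>(m, n). u ^ m * v ^ n) summable_on UNIV"
proof -
  have geo: "((\<lambda>n. w ^ n) has_sum (1 / (1 - w))) UNIV" if "0 \<le> w" "w < 1" for w :: real
    using that by (intro sums_nonneg_imp_has_sum geometric_sums) auto
  have "(\<lambda>(m, n). u ^ m * v ^ n) summable_on (Sigma UNIV (\<lambda>_. UNIV))"
  proof (rule summable_on_SigmaI)
    show "((\<lambda>n. case (m, n) of (m, n) \<Rightarrow> u ^ m * v ^ n) has_sum (u ^ m * (1 / (1 - v)))) UNIV"
      for m using has_sum_cmult_right[OF geo[OF assms(3,4)]] by simp
    show "(\<lambda>m. u ^ m * (1 / (1 - v))) summable_on UNIV"
      using has_sum_cmult_left[OF geo[OF assms(1,2)]] unfolding summable_on_def by blast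
  qed (use assms in auto)
  thus ?thesis by simp
qed

text \<open>
  The three Pochhammer quotients of a term contribute at most \<open>q\<^sup>2\<^sup>(\<^sup>m\<^sup>+\<^sup>n\<^sup>)\<close> up to a constant, for any
  \<open>q > 1\<close>. For \<open>q\<close> close enough to 1 the terms are dominated by a product of two convergent
  geometric series.
\<close>
lemma appell_F1_summable:
  fixes a b b' c x y :: complex
  assumes c: "\<And>j::nat. c \<noteq> - of_nat j" and x: "norm x < 1" and y: "norm y < 1"
  shows "(\<lambda>(m, n). pochhammer a (m + n) * pochhammer b m * pochhammer b' n /
            pochhammer c (m + n) * (x ^ m / fact m) * (y ^ n / fact n)) summable_on UNIV"
    (is "?f summable_on _")
proof -
  define r where "r = max (norm x) (norm y)"
  \<comment> \<open>This choice gives \<open>q > 1\<close> and \<open>q\<^sup>2 r < 1\<close>.\<close>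
  define q where "q = sqrt (2 / (1 + r))"
  have r: "0 \<le> r" "r < 1" "norm x \<le> r" "norm y \<le> r"
    using x y by (auto simp: r_def le_max_iff_disj)
  have q: "q > 1" and q2: "q ^ 2 = 2 / (1 + r)"
    using r by (auto simp: q_def real_sqrt_gt_1_iff)
  have qr: "q ^ 2 * s < 1" if "s \<le> r" for s
    using that r unfolding q2 by (simp add: divide_simps)
  have one: "(1 :: complex) \<noteq> - of_nat j" for j :: nat
    by (metis add.commute add_eq_0_iff of_nat_1 of_nat_add of_nat_eq_0_iff one_neq_zero add_is_0)
  obtain A where A: "\<And>n. norm (pochhammer a n / pochhammer c n) \<le> A * q ^ n"
    using pochhammer_quotient_bound[OF c q] by blast
  obtain B where B: "\<And>n. norm (pochhammer b n / pochhammer 1 n) \<le> B * q ^ n"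
    using pochhammer_quotient_bound[OF one q] by blast
  obtain B' where B': "\<And>n. norm (pochhammer b' n / pochhammer 1 n) \<le> B' * q ^ n"
    using pochhammer_quotient_bound[OF one q] by blast
  have nonneg: "A \<ge> 0" "B \<ge> 0" "B' \<ge> 0"
    using A[of 0] B[of 0] B'[of 0] by auto
  have "(\<lambda>(m, n). (A * B * B') * ((q\<^sup>2 * norm x) ^ m * (q\<^sup>2 * norm y) ^ n)) summable_on UNIV"
    using summable_on_cmult_right[OF summable_on_geometric_product[of "q\<^sup>2 * norm x" "q\<^sup>2 * norm y"], of "A * B * B'"]
      qr[of "norm x"] qr[of "norm y"] r by (simp add: case_prod_unfold)
  hence "(\<lambda>p. norm (?f p)) summable_on UNIV"
  proof (rule Infinite_Sum.abs_summable_on_comparison_test')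
    fix p :: "nat \<times> nat"
    obtain m n where p: "p = (m, n)" by force
    have "norm (?f p) = norm (pochhammer a (m + n) / pochhammer c (m + n)) *
             norm (pochhammer b m / pochhammer 1 m) * norm (pochhammer b' n / pochhammer 1 n) *
             (norm x ^ m * norm y ^ n)"
      by (simp add: p norm_mult norm_divide norm_power flip: pochhammer_fact)
    also have "\<dots> \<le> (A * q ^ (m + n)) * (B * q ^ m) * (B' * q ^ n) * (norm x ^ m * norm y ^ n)"
      using q nonneg by (intro mult_right_mono mult_mono A B B') auto
    also have "\<dots> = (A * B * B') * ((q\<^sup>2 * norm x) ^ m * (q\<^sup>2 * norm y) ^ n)"
      by (simp add: power_add power_mult_distrib power2_eq_square mult_ac)
    finally show "norm (?f p) \<le> (case p of (m, n) \<Rightarrow>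
                    (A * B * B') * ((q\<^sup>2 * norm x) ^ m * (q\<^sup>2 * norm y) ^ n))"
      by (simp add: p)
  qed
  thus ?thesis by (rule abs_summable_summable)
qed

lemma appell_F1_fps_sums:
  assumes c: "\<And>j::nat. c \<noteq> - of_nat j" and x: "norm x < 1" and y: "norm y < 1"
  shows "(\<lambda>N. appell_F1_fps a b b' c x y $ N) sums appell_F1 a b b' c x y"
proof (rule has_sum_imp_sums)
  let ?f = "\<lambda>(m, n). pochhammer a (m + n) * pochhammer b m * pochhammer b' n /
            pochhammer c (m + n) * (x ^ m / fact m) * (y ^ n / fact n)"
  let ?g = "\<lambda>(N, m). ?f (m, N - m)"
  have "(?f has_sum appell_F1 a b b' c x y) UNIV"
    using appell_F1_summable[OF assms] unfolding appell_F1_def by (rule has_sum_infsum)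
  also have "?this \<longleftrightarrow> (?g has_sum appell_F1 a b b' c x y) (Sigma UNIV (\<lambda>N. {0..N}))"
    by (rule has_sum_reindex_bij_witness[where i = "\<lambda>(N, m). (m, N - m)" and j = "\<lambda>(m, n). (m + n, m)"])
       auto
  finally have "(?g has_sum appell_F1 a b b' c x y) (Sigma UNIV (\<lambda>N. {0..N}))" .
  moreover have "((\<lambda>m. ?g (N, m)) has_sum appell_F1_fps a b b' c x y $ N) {0..N}" for N
    by (rule has_sum_finiteI)
       (auto simp: appell_F1_fps_def pochhammer_weight_def fps_mult_nth neg_binomial_fps_def
          sum_distrib_left mult_ac intro!: sum.cong)
  ultimately show "((\<lambda>N. appell_F1_fps a b b' c x y $ N) has_sum appell_F1 a b b' c x y) UNIV"
    by (rule has_sum_SigmaD)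
qed

lemma appell_F1_fps_nth_scale:
  "appell_F1_fps a b b' c (t * x) (t * y) $ N = appell_F1_fps a b b' c x y $ N * t ^ N"
proof -
  have "t ^ N = t ^ i * t ^ (N - i)" if "i \<le> N" for i
    using that by (simp flip: power_add)
  thus ?thesis
    by (auto simp: appell_F1_fps_def pochhammer_weight_def fps_mult_nth neg_binomial_fps_def
          sum_distrib_left sum_distrib_right power_mult_distrib mult_ac intro!: sum.cong)
qed

text \<open>
  The bound on the radius of convergence is strict because the conditions on \<open>t\<close> are open: they
  still hold at a real point slightly larger than \<open>norm t\<close>, where the series converges.
\<close>
lemma eval_appell_F1_fps:
  assumes c: "\<And>j::nat. c \<noteq> - of_nat j" and x: "norm (t * x) < 1" and y: "norm (t * y) < 1"
  shows "eval_fps (appell_F1_fps a b b' c x y) t = appell_F1 a b b' c (t * x) (t * y)"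
    and "ereal (norm t) < fps_conv_radius (appell_F1_fps a b b' c x y)"
proof -
  have sums: "(\<lambda>N. appell_F1_fps a b b' c x y $ N * t ^ N) sums appell_F1 a b b' c (t * x) (t * y)"
    if "norm (t * x) < 1" "norm (t * y) < 1" for t
    using appell_F1_fps_sums[OF c that] by (simp add: appell_F1_fps_nth_scale)
  show "eval_fps (appell_F1_fps a b b' c x y) t = appell_F1 a b b' c (t * x) (t * y)"
    using sums_unique[OF sums[OF x y]] by (simp add: eval_fps_def)
  define S where "S = {s. s * norm x < 1 \<and> s * norm y < 1}"
  have "open S"
    unfolding S_def by (intro open_Collect_conj open_Collect_less continuous_intros)
  moreover have "norm t \<in> S"
    using x y by (simp add: S_def norm_mult)
  ultimately obtain e where e: "e > 0" "ball (norm t) e \<subseteq> S"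
    using open_contains_ball by blast
  define s where "s = norm t + e / 2"
  have "s \<in> S" using e by (auto simp: s_def dist_real_def)
  moreover have s: "s > norm t" using e by (simp add: s_def)
  ultimately have "summable (\<lambda>N. appell_F1_fps a b b' c x y $ N * of_real s ^ N)"
    using norm_ge_zero[of t]
    by (intro sums_summable[OF sums]) (auto simp: S_def norm_mult simp del: norm_ge_zero)
  hence "ereal (norm (of_real s :: complex)) \<le> fps_conv_radius (appell_F1_fps a b b' c x y)"
    unfolding fps_conv_radius_def by (rule conv_radius_geI)
  moreover have "norm (of_real s :: complex) = s"
    using s norm_ge_zero[of t] by (simp del: norm_ge_zero)
  ultimately show "ereal (norm t) < fps_conv_radius (appell_F1_fps a b b' c x y)"
    using s by (metis ereal_less_eq(3) less_ereal.simps(1) less_le_trans)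
qed

section \<open>The transformation of the Appell function\<close>

text \<open>
  Analytic continuation in the scaling parameter \<open>t\<close> from a neighbourhood of 0 to \<open>t = 1\<close>. The
  condition that needs an argument is \<open>norm (t z) < norm (1 - x t)\<close> for \<open>z = x\<close> and
  \<open>z = y - x\<close>: it has to survive shrinking \<open>t\<close> to \<open>s t\<close> with \<open>0 \<le> s \<le> 1\<close>. It does, because
  \<open>norm (1/s - x t)\<close> is the distance of \<open>x t\<close> to the point \<open>1/s \<ge> 1\<close>, which grows as \<open>s\<close> decreases
  when \<open>Re (x t) \<le> 1\<close>.
\<close>
lemma appell_F1_transform:
  assumes c: "\<And>j::nat. c \<noteq> - of_nat j" and x: "norm x < 1" and y: "norm y < 1"
    and x': "norm (x / (1 - x)) < 1" and y': "norm ((x - y) / (1 - x)) < 1"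
  shows "appell_F1 a b b' c x y =
           (1 - x) powr (-a) *
           appell_F1 a (c - b - b') b' c (- (x / (1 - x))) (- ((x - y) / (1 - x)))"
proof -
  define F where "F = appell_F1_fps a b b' c x y"
  define G where "G = appell_F1_fps a (c - b - b') b' c (-x) (y - x)"
  define f where "f = eval_fps F"
  define g where "g = (\<lambda>t. (1 - x * t) powr (-a) * (eval_fps G \<circ> (\<lambda>t. t / (1 - x * t))) t)"
  define S where "S = {t. norm (t * x) < 1 \<and> norm (t * y) < 1 \<and>
                         norm (t * x) < norm (1 - x * t) \<and> norm (t * (y - x)) < norm (1 - x * t)}"
  have S_radius: "ereal (norm t) < fps_conv_radius F" if "t \<in> S" for t
    unfolding F_def by (rule eval_appell_F1_fps[OF c]) (use that in \<open>auto simp: S_def\<close>)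
  have Re_pos: "Re (1 - x * t) > 0" if "t \<in> S" for t
  proof -
    have "Re (x * t) \<le> norm (t * x)" using complex_Re_le_cmod[of "x * t"] by (simp add: mult.commute)
    also have "\<dots> < 1" using that by (simp add: S_def)
    finally show ?thesis by simp
  qed
  have nz: "1 - x * t \<noteq> 0" if "t \<in> S" for t
    using Re_pos[OF that] by force
  have args: "norm (t / (1 - x * t) * (-x)) < 1" "norm (t / (1 - x * t) * (y - x)) < 1"
    if "t \<in> S" for t
    using that nz[OF that] by (auto simp: S_def norm_mult norm_divide)
  have G_radius: "ereal (norm (t / (1 - x * t))) < fps_conv_radius G" if "t \<in> S" for t
    unfolding G_def by (rule eval_appell_F1_fps(2)[OF c args[OF that]])

  have "open S"
    unfolding S_def by (intro open_Collect_conj open_Collect_less continuous_intros)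
  have "0 \<in> S" by (simp add: S_def)
  have nx: "1 - x \<noteq> 0" using x by auto
  have "1 \<in> S"
    using x y x' y' nx by (simp add: S_def norm_divide norm_minus_commute)
  have "starlike S"
    unfolding starlike_def
  proof (intro bexI[of _ 0] ballI subsetI)
    fix t w assume t: "t \<in> S" and "w \<in> closed_segment 0 t"
    then obtain s where s: "0 \<le> s" "s \<le> 1" and w: "w = of_real s * t"
      by (auto simp: closed_segment_def scaleR_conv_of_real)
    \<comment> \<open>The monotonicity of the distance, multiplied by \<open>s\<close>.\<close>
    have shrink: "s * norm (1 - x * t) \<le> norm (1 - x * w)"
    proof -
      have tx: "norm (x * t) < 1" using t by (simp add: S_def mult.commute)
      define p where "p = x * t"
      have p: "Re p \<le> 1"
        using tx complex_Re_le_cmod[of p] by (simp add: p_def)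
      have "(norm (1 - of_real s * p))\<^sup>2 - (norm (of_real s * (1 - p)))\<^sup>2 =
              (1 - s) * ((1 - s) + 2 * s * (1 - Re p))"
        by (simp only: cmod_power2 minus_complex.sel times_complex.sel Re_complex_of_real
              Im_complex_of_real one_complex.sel) algebra
      also have "\<dots> \<ge> 0"
        using s p by (intro mult_nonneg_nonneg add_nonneg_nonneg) auto
      finally have "(norm (of_real s * (1 - p)))\<^sup>2 \<le> (norm (1 - of_real s * p))\<^sup>2"
        by linarith
      hence "norm (of_real s * (1 - p)) \<le> norm (1 - of_real s * p)"
        by (rule power2_le_imp_le) (rule norm_ge_zero)
      thus ?thesis
        using s by (simp add: w p_def norm_mult mult_ac)
    qed
    show "w \<in> S"
    proof (cases "s = 0")
      case True
      thus ?thesis using \<open>0 \<in> S\<close> w by simp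
    next
      case False
      have le: "s * u \<le> u" if "u \<ge> 0" for u
        using s that by (simp add: mult_left_le_one_le)
      have "norm (w * z) = s * norm (t * z)" for z
        using s by (simp add: w norm_mult)
      moreover have "s * u < norm (1 - x * w)" if "u < norm (1 - x * t)" for u
        using shrink that s False by (smt (verit) mult_strict_left_mono)
      ultimately show ?thesis
        using t le[of "norm (t * x)"] le[of "norm (t * y)"] by (auto simp: S_def)
    qed
  qed (fact \<open>0 \<in> S\<close>)
  hence "connected S" by (rule starlike_imp_connected)

  have "fps_conv_radius F > 0" "fps_conv_radius G > 0"
    using S_radius[OF \<open>0 \<in> S\<close>] G_radius[OF \<open>0 \<in> S\<close>] by (simp_all add: zero_ereal_def)
  hence "f has_fps_expansion F" and G: "eval_fps G has_fps_expansion G"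
    unfolding f_def by (auto intro: eval_fps_has_fps_expansion)
  have "g has_fps_expansion neg_binomial_fps x a * (G oo moebius_fps x)"
    unfolding g_def
    by (intro has_fps_expansion_mult has_fps_expansion_neg_binomial
          has_fps_expansion_compose[OF G] has_fps_expansion_moebius) auto
  also have "\<dots> = F"
    unfolding F_def G_def by (rule appell_F1_fps_transform[OF c, symmetric])
  finally have "eventually (\<lambda>t. f t = g t) (nhds 0)"
    using \<open>f has_fps_expansion F\<close> unfolding has_fps_expansion_def
    by (auto elim: eventually_elim2)
  then obtain U where U: "open U" "0 \<in> U" "\<And>t. t \<in> U \<Longrightarrow> f t = g t"
    by (auto simp: eventually_nhds)

  have args_1: "1 / (1 - x * 1) * (-x) = - (x / (1 - x))"
      "1 / (1 - x * 1) * (y - x) = - ((x - y) / (1 - x))"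
    using nx by (simp_all add: divide_simps)
  have "f 1 = g 1"
  proof (rule analytic_continuation_open[of "U \<inter> S" S f g])
    show "f holomorphic_on S"
      unfolding f_def by (rule holomorphic_on_eval_fps) (use S_radius in auto)
    have "eval_fps G \<circ> (\<lambda>t. t / (1 - x * t)) holomorphic_on S"
    proof (rule holomorphic_on_compose)
      show "(\<lambda>t. t / (1 - x * t)) holomorphic_on S"
        using nz by (auto intro!: holomorphic_intros)
      show "eval_fps G holomorphic_on (\<lambda>t. t / (1 - x * t)) ` S"
        by (rule holomorphic_on_eval_fps) (use G_radius in auto)
    qed
    moreover have "1 - x * t \<notin> \<real>\<^sub>\<le>\<^sub>0" if "t \<in> S" for t
      using Re_pos[OF that] by (auto simp: complex_nonpos_Reals_iff)
    ultimately show "g holomorphic_on S"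
      unfolding g_def by (intro holomorphic_intros) (auto simp: o_def)
  qed (use U \<open>open S\<close> \<open>connected S\<close> \<open>0 \<in> S\<close> \<open>1 \<in> S\<close> in auto)
  moreover have "f 1 = appell_F1 a b b' c x y"
    using eval_appell_F1_fps(1)[OF c, of 1 x y] x y by (simp add: f_def F_def)
  moreover have "g 1 = (1 - x) powr (-a) *
      appell_F1 a (c - b - b') b' c (- (x / (1 - x))) (- ((x - y) / (1 - x)))"
    using eval_appell_F1_fps(1)[OF c args[OF \<open>1 \<in> S\<close>]]
    unfolding g_def G_def o_def args_1 by simp
  ultimately show ?thesis by simp
qed

lemma appell_F1_commute: "appell_F1 a b b' c x y = appell_F1 a b' b c y x"
  unfolding appell_F1_def
  by (rule infsum_reindex_bij_witness[where i = prod.swap and j = prod.swap])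
     (auto simp: add.commute mult_ac)

section \<open>Scaling to general step size\<close>
lemma pochhammer_k_eq:
  assumes "k > 0"
  shows "pochhammer_k k a n = of_real k ^ n * pochhammer (a / of_real k) n"
proof -
  have "(\<Prod>i<n. a + of_nat i * of_real k) = (\<Prod>i<n. of_real k * (a / of_real k + of_nat i))"
    using assms by (intro prod.cong) (auto simp: field_simps)
  thus ?thesis
    by (simp add: pochhammer_k_def pochhammer_prod prod.distrib atLeast0LessThan)
qed

lemma appell_F1_k_eq:
  assumes "k > 0"
  shows "appell_F1_k k a b b' c x y =
           appell_F1 (a / of_real k) (b / of_real k) (b' / of_real k) (c / of_real k)
             (of_real k * x) (of_real k * y)"
  unfolding appell_F1_k_def appell_F1_def
  using assms by (intro infsum_cong) (auto simp: pochhammer_k_eq power_mult_distrib power_add)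

lemma appell_F1_k_commute:
  assumes "k > 0"
  shows "appell_F1_k k a b b' c x y = appell_F1_k k a b' b c y x"
  unfolding appell_F1_k_eq[OF assms] by (rule appell_F1_commute)

lemma appell_F1_k_transform:
  fixes k :: real and a b b' c x y :: complex
  assumes k: "k > 0"
    and c: "\<And>j::nat. c \<noteq> - (of_nat j * of_real k)"
    and x: "norm x < 1 / k" and y: "norm y < 1 / k"
    and x': "norm (x / (1 - of_real k * x)) < 1 / k"
    and y': "norm ((x - y) / (1 - of_real k * x)) < 1 / k"
  shows "appell_F1_k k a b b' c x y =
           (1 - of_real k * x) powr (- (a / of_real k)) *
           appell_F1_k k a (c - b - b') b' c
             (- (x / (1 - of_real k * x))) (- ((x - y) / (1 - of_real k * x)))"
proof -
  have scale: "norm (of_real k * z) < 1 \<longleftrightarrow> norm z < 1 / k" for z :: complex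
    using k by (simp add: norm_mult field_simps)
  have c': "c / of_real k \<noteq> - of_nat j" for j :: nat
    using c[of j] k by (auto simp: field_simps)
  have "appell_F1 (a / of_real k) (b / of_real k) (b' / of_real k) (c / of_real k)
          (of_real k * x) (of_real k * y) =
        (1 - of_real k * x) powr (- (a / of_real k)) *
        appell_F1 (a / of_real k) (c / of_real k - b / of_real k - b' / of_real k)
          (b' / of_real k) (c / of_real k)
          (- (of_real k * x / (1 - of_real k * x)))
          (- ((of_real k * x - of_real k * y) / (1 - of_real k * x)))"
    using x y x' y'
    by (intro appell_F1_transform c')
       (simp_all only: scale times_divide_eq_right[symmetric] right_diff_distrib[symmetric])
  thus ?thesis
    by (simp add: appell_F1_k_eq[OF k] diff_divide_distrib right_diff_distrib)
qed

theorem theorem10: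
  fixes k :: real and \<alpha> \<beta> \<beta>' \<gamma> x y :: complex
  assumes "k > 0"
    and "\<And>j::nat. \<gamma> \<noteq> - (of_nat j * of_real k)"
    and "norm x < 1 / k" and "norm y < 1 / k"
  shows "(norm (x / (1 - of_real k * x)) < 1 / k \<longrightarrow>
          norm ((x - y) / (1 - of_real k * x)) < 1 / k \<longrightarrow>
          appell_F1_k k \<alpha> \<beta> \<beta>' \<gamma> x y =
            (1 - of_real k * x) powr (- (\<alpha> / of_real k)) *
            appell_F1_k k \<alpha> (\<gamma> - \<beta> - \<beta>') \<beta>' \<gamma>
              (- (x / (1 - of_real k * x))) (- ((x - y) / (1 - of_real k * x)))) \<and>
         (norm (y / (1 - of_real k * y)) < 1 / k \<longrightarrow>
          norm ((y - x) / (1 - of_real k * y)) < 1 / k \<longrightarrow>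
          appell_F1_k k \<alpha> \<beta> \<beta>' \<gamma> x y =
            (1 - of_real k * y) powr (- (\<alpha> / of_real k)) *
            appell_F1_k k \<alpha> \<beta> (\<gamma> - \<beta> - \<beta>') \<gamma>
              (- ((y - x) / (1 - of_real k * y))) (- (y / (1 - of_real k * y))))"
proof (intro conjI impI)
  assume "norm (x / (1 - of_real k * x)) < 1 / k" "norm ((x - y) / (1 - of_real k * x)) < 1 / k"
  thus "appell_F1_k k \<alpha> \<beta> \<beta>' \<gamma> x y =
          (1 - of_real k * x) powr (- (\<alpha> / of_real k)) *
          appell_F1_k k \<alpha> (\<gamma> - \<beta> - \<beta>') \<beta>' \<gamma>
            (- (x / (1 - of_real k * x))) (- ((x - y) / (1 - of_real k * x)))"
    by (rule appell_F1_k_transform[OF assms])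
next
  assume *: "norm (y / (1 - of_real k * y)) < 1 / k" "norm ((y - x) / (1 - of_real k * y)) < 1 / k"
  have "appell_F1_k k \<alpha> \<beta> \<beta>' \<gamma> x y = appell_F1_k k \<alpha> \<beta>' \<beta> \<gamma> y x"
    by (rule appell_F1_k_commute[OF assms(1)])
  also have "\<dots> = (1 - of_real k * y) powr (- (\<alpha> / of_real k)) *
      appell_F1_k k \<alpha> (\<gamma> - \<beta>' - \<beta>) \<beta> \<gamma>
        (- (y / (1 - of_real k * y))) (- ((y - x) / (1 - of_real k * y)))"
    by (rule appell_F1_k_transform[OF assms(1,2,4,3) *])
  also have "\<gamma> - \<beta>' - \<beta> = \<gamma> - \<beta> - \<beta>'"
    by simp
  also have "appell_F1_k k \<alpha> (\<gamma> - \<beta> - \<beta>') \<beta> \<gamma>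
        (- (y / (1 - of_real k * y))) (- ((y - x) / (1 - of_real k * y))) =
      appell_F1_k k \<alpha> \<beta> (\<gamma> - \<beta> - \<beta>') \<gamma>
        (- ((y - x) / (1 - of_real k * y))) (- (y / (1 - of_real k * y)))"
    by (rule appell_F1_k_commute[OF assms(1)])
  finally show "appell_F1_k k \<alpha> \<beta> \<beta>' \<gamma> x y = (1 - of_real k * y) powr (- (\<alpha> / of_real k)) *
      appell_F1_k k \<alpha> \<beta> (\<gamma> - \<beta> - \<beta>') \<gamma>
        (- ((y - x) / (1 - of_real k * y))) (- (y / (1 - of_real k * y)))" .
qed

end
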